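(* Let $A\subseteq\mathrm{Ag}$ and let $\mathsf{L}_1,\mathsf{L}_2$ be logics with fixed-point operators such that $\mathsf{L}_1(\alpha)=\mathsf{L}_2(\alpha)\cup\{4\}$ for $\alpha\in A$ and $\mathsf{L}_1(\alpha)=\mathsf{L}_2(\alpha)$ otherwise, and such that each $\mathsf{L}_2(\alpha)$ is contained in $\{D,T,B\}$. Then a formula $\varphi$ is $\mathsf{L}_1$-satisfiable if and only if $\mathrm{tr}^4_A(\varphi)$ is $\mathsf{L}_2$-satisfiable, where $\mathrm{tr}^4_A$ commutes with all other operations, and for $\alpha\in A$: $\mathrm{tr}^4_A([\alpha]\psi)=\mathsf{Inv}^\alpha([\alpha]\mathrm{tr}^4_A(\psi))$ and $\mathrm{tr}^4_A(\langle\alpha\rangle\psi)=\mathsf{Eve}^\alpha(\langle\alpha\rangle\mathrm{tr}^4_A(\psi))$.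
   Context: Formulas: $\varphi ::= p \mid \neg p \mid \mathtt{tt} \mid \mathtt{ff} \mid X \mid \varphi\wedge\varphi \mid \varphi\vee\varphi \mid \langle\alpha\rangle\varphi \mid [\alpha]\varphi \mid \mu X.\varphi \mid \nu X.\varphi$ over a finite agent set $\mathrm{Ag}$ and finitely many propositional variables; closed formulas only; interpreted on Kripke models $(W,R,V)$, $R\subseteq W\times\mathrm{Ag}\times W$, with the semantics of the multi-agent modal $\mu$-calculus. Frame conditions on $R_\alpha$: $D$ serial, $T$ reflexive, $B$ symmetric, $4$ transitive. A logic $\mathsf{L}$ assigns to each agent a set $\mathsf{L}(\alpha)$ of conditions; $\mathsf{L}$-models are Kripke models where each $R_\alpha$ satisfies $\mathsf{L}(\alpha)$; $\varphi$ is $\mathsf{L}$-satisfiable if true at some state of some $\mathsf{L}$-model. For a formula $\chi$ and agent $\alpha$ (with $X$ a fresh fixed-point variable): $\mathsf{Inv}^\alpha(\chi)=\nu X.(\chi\wedge[\alpha]X)$ and $\mathsf{Eve}^\alpha(\chi)=\mu X.(\chi\vee\langle\alpha\rangle X)$. *)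

theory Defs
  imports Main
begin

datatype ('ag, 'p) fm =
    Prop 'p
  | NProp 'p
  | TT
  | FF
  | Var nat
  | And "('ag, 'p) fm" "('ag, 'p) fm"
  | Or "('ag, 'p) fm" "('ag, 'p) fm"
  | Dia 'ag "('ag, 'p) fm"
  | Box 'ag "('ag, 'p) fm"
  | Mu nat "('ag, 'p) fm"
  | Nu nat "('ag, 'p) fm"

primrec fv :: "('ag, 'p) fm \<Rightarrow> nat set" where
  "fv (Prop p) = {}"
| "fv (NProp p) = {}"
| "fv TT = {}"
| "fv FF = {}"
| "fv (Var X) = {X}"
| "fv (And \<phi> \<psi>) = fv \<phi> \<union> fv \<psi>"
| "fv (Or \<phi> \<psi>) = fv \<phi> \<union> fv \<psi>"
| "fv (Dia \<alpha> \<phi>) = fv \<phi>"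
| "fv (Box \<alpha> \<phi>) = fv \<phi>"
| "fv (Mu X \<phi>) = fv \<phi> - {X}"
| "fv (Nu X \<phi>) = fv \<phi> - {X}"

text \<open>All fixed-point variables occurring in a formula: free, bound or binding.\<close>

primrec vars :: "('ag, 'p) fm \<Rightarrow> nat set" where
  "vars (Prop p) = {}"
| "vars (NProp p) = {}"
| "vars TT = {}"
| "vars FF = {}"
| "vars (Var X) = {X}"
| "vars (And \<phi> \<psi>) = vars \<phi> \<union> vars \<psi>"
| "vars (Or \<phi> \<psi>) = vars \<phi> \<union> vars \<psi>"
| "vars (Dia \<alpha> \<phi>) = vars \<phi>"
| "vars (Box \<alpha> \<phi>) = vars \<phi>"
| "vars (Mu X \<phi>) = insert X (vars \<phi>)"
| "vars (Nu X \<phi>) = insert X (vars \<phi>)"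

definition closed_fm :: "('ag, 'p) fm \<Rightarrow> bool" where
  "closed_fm \<phi> \<longleftrightarrow> fv \<phi> = {}"

record ('w, 'ag, 'p) kripke =
  worlds :: "'w set"
  acc :: "('w \<times> 'ag \<times> 'w) set"
  val :: "'w \<Rightarrow> 'p set"

definition kripke_model :: "('w, 'ag, 'p) kripke \<Rightarrow> bool" where
  "kripke_model M \<longleftrightarrow> worlds M \<noteq> {} \<and> acc M \<subseteq> worlds M \<times> UNIV \<times> worlds M"

definition acc_of :: "('w, 'ag, 'p) kripke \<Rightarrow> 'ag \<Rightarrow> ('w \<times> 'w) set" where
  "acc_of M \<alpha> = {(u, v). (u, \<alpha>, v) \<in> acc M}"

primrec sem :: "('w, 'ag, 'p) kripke \<Rightarrow> (nat \<Rightarrow> 'w set) \<Rightarrow> ('ag, 'p) fm \<Rightarrow> 'w set" where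
  "sem M \<rho> (Prop p) = {w \<in> worlds M. p \<in> val M w}"
| "sem M \<rho> (NProp p) = {w \<in> worlds M. p \<notin> val M w}"
| "sem M \<rho> TT = worlds M"
| "sem M \<rho> FF = {}"
| "sem M \<rho> (Var X) = \<rho> X"
| "sem M \<rho> (And \<phi> \<psi>) = sem M \<rho> \<phi> \<inter> sem M \<rho> \<psi>"
| "sem M \<rho> (Or \<phi> \<psi>) = sem M \<rho> \<phi> \<union> sem M \<rho> \<psi>"
| "sem M \<rho> (Dia \<alpha> \<phi>) = {w \<in> worlds M. \<exists>v. (w, v) \<in> acc_of M \<alpha> \<and> v \<in> sem M \<rho> \<phi>}"
| "sem M \<rho> (Box \<alpha> \<phi>) = {w \<in> worlds M. \<forall>v. (w, v) \<in> acc_of M \<alpha> \<longrightarrow> v \<in> sem M \<rho> \<phi>}"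
| "sem M \<rho> (Mu X \<phi>) = \<Inter>{S. S \<subseteq> worlds M \<and> sem M (\<rho>(X := S)) \<phi> \<subseteq> S}"
| "sem M \<rho> (Nu X \<phi>) = \<Union>{S. S \<subseteq> worlds M \<and> S \<subseteq> sem M (\<rho>(X := S)) \<phi>}"

lemma sem_cong:
  "(\<And>X. X \<in> fv \<phi> \<Longrightarrow> \<rho> X = \<rho>' X) \<Longrightarrow> sem M \<rho> \<phi> = sem M \<rho>' \<phi>"
proof (induction \<phi> arbitrary: \<rho> \<rho>')
  case (And \<phi> \<psi>)
  have "sem M \<rho> \<phi> = sem M \<rho>' \<phi>" "sem M \<rho> \<psi> = sem M \<rho>' \<psi>"
    by (rule And.IH; simp add: And.prems)+
  then show ?case by simp
next
  case (Or \<phi> \<psi>)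
  have "sem M \<rho> \<phi> = sem M \<rho>' \<phi>" "sem M \<rho> \<psi> = sem M \<rho>' \<psi>"
    by (rule Or.IH; simp add: Or.prems)+
  then show ?case by simp
next
  case (Dia \<alpha> \<phi>)
  have "sem M \<rho> \<phi> = sem M \<rho>' \<phi>" by (rule Dia.IH) (simp add: Dia.prems)
  then show ?case by simp
next
  case (Box \<alpha> \<phi>)
  have "sem M \<rho> \<phi> = sem M \<rho>' \<phi>" by (rule Box.IH) (simp add: Box.prems)
  then show ?case by simp
next
  case (Mu X \<phi>)
  have "sem M (\<rho>(X := S)) \<phi> = sem M (\<rho>'(X := S)) \<phi>" for S
    by (rule Mu.IH) (simp add: Mu.prems)
  then show ?case by simp
next
  case (Nu X \<phi>)
  have "sem M (\<rho>(X := S)) \<phi> = sem M (\<rho>'(X := S)) \<phi>" for S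
    by (rule Nu.IH) (simp add: Nu.prems)
  then show ?case by simp
qed simp_all

text \<open>For closed formulas the choice of the environment is immaterial.\<close>

definition true_at :: "('w, 'ag, 'p) kripke \<Rightarrow> 'w \<Rightarrow> ('ag, 'p) fm \<Rightarrow> bool" where
  "true_at M w \<phi> \<longleftrightarrow> w \<in> sem M (\<lambda>_. {}) \<phi>"

lemma true_at_closed: "closed_fm \<phi> \<Longrightarrow> true_at M w \<phi> \<longleftrightarrow> w \<in> sem M \<rho> \<phi>"
  unfolding true_at_def closed_fm_def by (metis empty_iff sem_cong)

datatype frame_cond = CondD | CondT | CondB | Cond4

primrec satisfies_cond :: "'w set \<Rightarrow> ('w \<times> 'w) set \<Rightarrow> frame_cond \<Rightarrow> bool" where
  "satisfies_cond W r CondD \<longleftrightarrow> (\<forall>w\<in>W. \<exists>v\<in>W. (w, v) \<in> r)"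
| "satisfies_cond W r CondT \<longleftrightarrow> refl_on W r"
| "satisfies_cond W r CondB \<longleftrightarrow> sym r"
| "satisfies_cond W r Cond4 \<longleftrightarrow> trans r"

type_synonym 'ag modal_logic = "'ag \<Rightarrow> frame_cond set"

definition L_model :: "'ag modal_logic \<Rightarrow> ('w, 'ag, 'p) kripke \<Rightarrow> bool" where
  "L_model L M \<longleftrightarrow>
     kripke_model M \<and> (\<forall>\<alpha>. \<forall>c\<in>L \<alpha>. satisfies_cond (worlds M) (acc_of M \<alpha>) c)"

text \<open>
  HOL cannot quantify over types, so the type from which the worlds are drawn is a parameter;
  the worlds of a model form an arbitrary non-empty subset of that type.
\<close>

definition satisfiable :: "'w itself \<Rightarrow> 'ag modal_logic \<Rightarrow> ('ag, 'p) fm \<Rightarrow> bool" where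
  "satisfiable (_ :: 'w itself) L \<phi> \<longleftrightarrow>
     (\<exists>M :: ('w, 'ag, 'p) kripke. L_model L M \<and> (\<exists>w\<in>worlds M. true_at M w \<phi>))"

definition fresh :: "('ag, 'p) fm \<Rightarrow> nat" where
  "fresh \<chi> = (LEAST X. X \<notin> vars \<chi>)"

definition Inv :: "'ag \<Rightarrow> ('ag, 'p) fm \<Rightarrow> ('ag, 'p) fm" where
  "Inv \<alpha> \<chi> = (let X = fresh \<chi> in Nu X (And \<chi> (Box \<alpha> (Var X))))"

definition Eve :: "'ag \<Rightarrow> ('ag, 'p) fm \<Rightarrow> ('ag, 'p) fm" where
  "Eve \<alpha> \<chi> = (let X = fresh \<chi> in Mu X (Or \<chi> (Dia \<alpha> (Var X))))"

primrec tr4 :: "'ag set \<Rightarrow> ('ag, 'p) fm \<Rightarrow> ('ag, 'p) fm" where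
  "tr4 A (Prop p) = Prop p"
| "tr4 A (NProp p) = NProp p"
| "tr4 A TT = TT"
| "tr4 A FF = FF"
| "tr4 A (Var X) = Var X"
| "tr4 A (And \<phi> \<psi>) = And (tr4 A \<phi>) (tr4 A \<psi>)"
| "tr4 A (Or \<phi> \<psi>) = Or (tr4 A \<phi>) (tr4 A \<psi>)"
| "tr4 A (Dia \<alpha> \<phi>) = (if \<alpha> \<in> A then Eve \<alpha> (Dia \<alpha> (tr4 A \<phi>)) else Dia \<alpha> (tr4 A \<phi>))"
| "tr4 A (Box \<alpha> \<phi>) = (if \<alpha> \<in> A then Inv \<alpha> (Box \<alpha> (tr4 A \<phi>)) else Box \<alpha> (tr4 A \<phi>))"
| "tr4 A (Mu X \<phi>) = Mu X (tr4 A \<phi>)"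
| "tr4 A (Nu X \<phi>) = Nu X (tr4 A \<phi>)"

lemma finite_vars: "finite (vars \<phi>)"
  by (induction \<phi>) auto

lemma fv_subset_vars: "fv \<phi> \<subseteq> vars \<phi>"
  by (induction \<phi>) auto

lemma fresh_notin_vars: "fresh \<chi> \<notin> vars \<chi>"
  unfolding fresh_def by (rule LeastI_ex) (metis ex_new_if_finite finite_vars infinite_UNIV_nat)

lemma fv_Inv: "fv (Inv \<alpha> \<chi>) = fv \<chi>"
  using fresh_notin_vars[of \<chi>] fv_subset_vars[of \<chi>] by (auto simp: Inv_def Let_def)

lemma fv_Eve: "fv (Eve \<alpha> \<chi>) = fv \<chi>"
  using fresh_notin_vars[of \<chi>] fv_subset_vars[of \<chi>] by (auto simp: Eve_def Let_def)

lemma fv_tr4: "fv (tr4 A \<phi>) = fv \<phi>"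
  by (induction \<phi>) (auto simp: fv_Inv fv_Eve)

lemma closed_tr4: "closed_fm \<phi> \<Longrightarrow> closed_fm (tr4 A \<phi>)"
  by (simp add: closed_fm_def fv_tr4)

end

theory Submission
  imports Defs
begin

text \<open>
  \<open>Eve\<close> and \<open>Inv\<close> quantify over the worlds reachable in any number of steps, so in front of a
  modality they make it range over the transitive closure of its relation. Hence \<open>tr4 A \<phi>\<close> has in a
  model the value that \<open>\<phi>\<close> has once the relations of the agents in \<open>A\<close> are closed under
  transitivity. This closure preserves all frame conditions and does nothing to a model that is
  already transitive for the agents in \<open>A\<close>.
\<close>

lemma kripke_model_iff_acc_of:
  "kripke_model M \<longleftrightarrow> worlds M \<noteq> {} \<and> (\<forall>\<alpha>. acc_of M \<alpha> \<subseteq> worlds M \<times> worlds M)"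
  by (fastforce simp: kripke_model_def acc_of_def)

lemma acc_of_subset: "kripke_model M \<Longrightarrow> acc_of M \<alpha> \<subseteq> worlds M \<times> worlds M"
  by (simp add: kripke_model_iff_acc_of)

lemma kripke_eqI:
  fixes M N :: "('w, 'ag, 'p) kripke"
  assumes "worlds M = worlds N" "val M = val N" "\<And>\<alpha>. acc_of M \<alpha> = acc_of N \<alpha>"
  shows "M = N"
proof -
  have "acc M = acc N"
    using assms(3) by (auto simp: acc_of_def set_eq_iff)
  with assms(1,2) show ?thesis by simp
qed

lemma sem_fun_upd_fresh [simp]: "sem M (\<rho>(fresh \<chi> := S)) \<chi> = sem M \<rho> \<chi>"
proof (rule sem_cong)
  fix X assume "X \<in> fv \<chi>"
  then have "X \<noteq> fresh \<chi>"
    using fv_subset_vars fresh_notin_vars by blast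
  then show "(\<rho>(fresh \<chi> := S)) X = \<rho> X" by simp
qed

lemma sem_Mu_eqI:
  assumes "S \<subseteq> worlds M" "sem M (\<rho>(X := S)) \<phi> \<subseteq> S"
    and "\<And>T. \<lbrakk>T \<subseteq> worlds M; sem M (\<rho>(X := T)) \<phi> \<subseteq> T\<rbrakk> \<Longrightarrow> S \<subseteq> T"
  shows "sem M \<rho> (Mu X \<phi>) = S"
  unfolding sem.simps using assms by (intro Inf_eqI) auto

lemma sem_Nu_eqI:
  assumes "S \<subseteq> worlds M" "S \<subseteq> sem M (\<rho>(X := S)) \<phi>"
    and "\<And>T. \<lbrakk>T \<subseteq> worlds M; T \<subseteq> sem M (\<rho>(X := T)) \<phi>\<rbrakk> \<Longrightarrow> T \<subseteq> S"
  shows "sem M \<rho> (Nu X \<phi>) = S"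
  unfolding sem.simps using assms by (intro Sup_eqI) auto

text \<open>
  Free variables can take the value of \<open>\<chi>\<close> outside \<open>worlds M\<close>; the least fixed point is then the
  intersection of an empty family, that is, \<open>UNIV\<close>.
\<close>

lemma sem_Eve:
  assumes "kripke_model M" and \<chi>: "sem M \<rho> \<chi> \<subseteq> worlds M"
  shows "sem M \<rho> (Eve \<alpha> \<chi>) = {w. \<exists>v\<in>sem M \<rho> \<chi>. (w, v) \<in> (acc_of M \<alpha>)\<^sup>*}" (is "_ = ?E")
  unfolding Eve_def Let_def
proof (rule sem_Mu_eqI)
  note acc = acc_of_subset[OF assms(1), of \<alpha>]
  show "?E \<subseteq> worlds M"
    using acc \<chi> by (auto elim: converse_rtranclE)
  show "sem M (\<rho>(fresh \<chi> := ?E)) (Or \<chi> (Dia \<alpha> (Var (fresh \<chi>)))) \<subseteq> ?E"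
    by (auto intro: converse_rtrancl_into_rtrancl)
  fix T assume T: "sem M (\<rho>(fresh \<chi> := T)) (Or \<chi> (Dia \<alpha> (Var (fresh \<chi>)))) \<subseteq> T"
  show "?E \<subseteq> T"
  proof
    fix w assume "w \<in> ?E"
    then obtain v where "(w, v) \<in> (acc_of M \<alpha>)\<^sup>*" and v: "v \<in> sem M \<rho> \<chi>" by blast
    then show "w \<in> T"
    proof (induction rule: converse_rtrancl_induct)
      case base
      then show ?case using T by auto
    next
      case (step u u')
      then show ?case using T acc by auto
    qed
  qed
qed

lemma sem_Inv:
  assumes "kripke_model M"
  shows "sem M \<rho> (Inv \<alpha> \<chi>) =
    {w \<in> worlds M. \<forall>v. (w, v) \<in> (acc_of M \<alpha>)\<^sup>* \<longrightarrow> v \<in> sem M \<rho> \<chi>}" (is "_ = ?I")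
  unfolding Inv_def Let_def
proof (rule sem_Nu_eqI)
  note acc = acc_of_subset[OF assms, of \<alpha>]
  show "?I \<subseteq> worlds M" by blast
  show "?I \<subseteq> sem M (\<rho>(fresh \<chi> := ?I)) (And \<chi> (Box \<alpha> (Var (fresh \<chi>))))"
    using acc by (auto intro: converse_rtrancl_into_rtrancl)
  fix T assume T: "T \<subseteq> worlds M"
    "T \<subseteq> sem M (\<rho>(fresh \<chi> := T)) (And \<chi> (Box \<alpha> (Var (fresh \<chi>))))"
  show "T \<subseteq> ?I"
  proof
    fix w assume w: "w \<in> T"
    have "v \<in> T" if "(w, v) \<in> (acc_of M \<alpha>)\<^sup>*" for v
      using that
    proof (induction rule: rtrancl_induct)
      case base
      show ?case by (fact w)
    next
      case (step u v)
      then show ?case using T(2) by auto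
    qed
    then show "w \<in> ?I" using T w by auto
  qed
qed

lemma sem_Eve_Dia:
  assumes "kripke_model M"
  shows "sem M \<rho> (Eve \<alpha> (Dia \<alpha> \<psi>)) =
    {w \<in> worlds M. \<exists>v. (w, v) \<in> (acc_of M \<alpha>)\<^sup>+ \<and> v \<in> sem M \<rho> \<psi>}"
proof -
  have "(acc_of M \<alpha>)\<^sup>+ \<subseteq> worlds M \<times> worlds M"
    using acc_of_subset[OF assms] by (rule trancl_subset_Sigma)
  then show ?thesis
    by (auto simp: sem_Eve[OF assms] trancl_unfold_right
        dest: acc_of_subset[OF assms, THEN subsetD])
qed

lemma sem_Inv_Box:
  assumes "kripke_model M"
  shows "sem M \<rho> (Inv \<alpha> (Box \<alpha> \<psi>)) =
    {w \<in> worlds M. \<forall>v. (w, v) \<in> (acc_of M \<alpha>)\<^sup>+ \<longrightarrow> v \<in> sem M \<rho> \<psi>}"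
proof -
  have "v \<in> worlds M" if "(w, v) \<in> (acc_of M \<alpha>)\<^sup>*" "w \<in> worlds M" for w v
    using that acc_of_subset[OF assms] by (auto elim: rtranclE)
  then show ?thesis
    by (auto simp: sem_Inv[OF assms] trancl_unfold_right)
qed

definition trancl_model :: "'ag set \<Rightarrow> ('w, 'ag, 'p) kripke \<Rightarrow> ('w, 'ag, 'p) kripke" where
  "trancl_model A M =
     M\<lparr>acc := {(u, \<alpha>, v). (u, v) \<in> (if \<alpha> \<in> A then (acc_of M \<alpha>)\<^sup>+ else acc_of M \<alpha>)}\<rparr>"

lemma trancl_model_simps [simp]:
  "worlds (trancl_model A M) = worlds M"
  "val (trancl_model A M) = val M"
  "acc_of (trancl_model A M) \<alpha> = (if \<alpha> \<in> A then (acc_of M \<alpha>)\<^sup>+ else acc_of M \<alpha>)"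
  by (auto simp: trancl_model_def acc_of_def)

lemma kripke_model_trancl_model: "kripke_model M \<Longrightarrow> kripke_model (trancl_model A M)"
  by (simp add: kripke_model_iff_acc_of trancl_subset_Sigma)

lemma trancl_model_id:
  "(\<And>\<alpha>. \<alpha> \<in> A \<Longrightarrow> trans (acc_of M \<alpha>)) \<Longrightarrow> trancl_model A M = M"
  by (rule kripke_eqI) simp_all

lemma sem_tr4:
  assumes "kripke_model M"
  shows "sem M \<rho> (tr4 A \<phi>) = sem (trancl_model A M) \<rho> \<phi>"
  by (induction \<phi> arbitrary: \<rho>) (simp_all add: sem_Eve_Dia[OF assms] sem_Inv_Box[OF assms])

lemma satisfies_cond_trancl: "satisfies_cond W r c \<Longrightarrow> satisfies_cond W (r\<^sup>+) c"
  by (cases c) (auto simp: refl_on_def sym_trancl)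

definition add_Cond4 :: "'ag set \<Rightarrow> 'ag modal_logic \<Rightarrow> 'ag modal_logic" where
  "add_Cond4 A L = (\<lambda>\<alpha>. if \<alpha> \<in> A then insert Cond4 (L \<alpha>) else L \<alpha>)"

lemma L_model_add_Cond4_iff:
  "L_model (add_Cond4 A L) M \<longleftrightarrow> L_model L M \<and> (\<forall>\<alpha>\<in>A. trans (acc_of M \<alpha>))"
  by (auto simp: L_model_def add_Cond4_def split: if_splits)

lemma L_model_trancl_model: "L_model L M \<Longrightarrow> L_model L (trancl_model A M)"
  by (simp add: L_model_def kripke_model_trancl_model satisfies_cond_trancl)

lemma true_at_tr4:
  "L_model L M \<Longrightarrow> true_at M w (tr4 A \<phi>) \<longleftrightarrow> true_at (trancl_model A M) w \<phi>"
  by (simp add: true_at_def sem_tr4 L_model_def)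

theorem satisfiable_tr4:
  fixes \<phi> :: "('ag, 'p) fm"
  shows "satisfiable TYPE('w) L (tr4 A \<phi>) \<longleftrightarrow> satisfiable TYPE('w) (add_Cond4 A L) \<phi>"
proof
  assume "satisfiable TYPE('w) L (tr4 A \<phi>)"
  then obtain M :: "('w, 'ag, 'p) kripke" and w
    where M: "L_model L M" and w: "w \<in> worlds M" "true_at M w (tr4 A \<phi>)"
    by (auto simp: satisfiable_def)
  have "L_model (add_Cond4 A L) (trancl_model A M)"
    using M by (simp add: L_model_add_Cond4_iff L_model_trancl_model)
  moreover have "true_at (trancl_model A M) w \<phi>"
    using M w(2) by (simp add: true_at_tr4)
  ultimately show "satisfiable TYPE('w) (add_Cond4 A L) \<phi>"
    using w(1) unfolding satisfiable_def by (metis trancl_model_simps(1))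
next
  assume "satisfiable TYPE('w) (add_Cond4 A L) \<phi>"
  then obtain M :: "('w, 'ag, 'p) kripke" and w
    where M: "L_model L M" and trans: "\<forall>\<alpha>\<in>A. trans (acc_of M \<alpha>)"
      and w: "w \<in> worlds M" "true_at M w \<phi>"
    by (auto simp: satisfiable_def L_model_add_Cond4_iff)
  have "trancl_model A M = M"
    using trans by (simp add: trancl_model_id)
  then have "true_at M w (tr4 A \<phi>)"
    using M w(2) by (simp add: true_at_tr4)
  then show "satisfiable TYPE('w) L (tr4 A \<phi>)"
    using M w(1) by (auto simp: satisfiable_def)
qed

theorem theorem3p18:
  fixes A :: "'ag::finite set"
    and L1 L2 :: "'ag modal_logic"
    and \<phi> :: "('ag, 'p::finite) fm"
  assumes "\<And>\<alpha>. \<alpha> \<in> A \<Longrightarrow> L1 \<alpha> = L2 \<alpha> \<union> {Cond4}"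
    and "\<And>\<alpha>. \<alpha> \<notin> A \<Longrightarrow> L1 \<alpha> = L2 \<alpha>"
    and "\<And>\<alpha>. L2 \<alpha> \<subseteq> {CondD, CondT, CondB}"
    and "closed_fm \<phi>"
  shows "satisfiable TYPE('w) L1 \<phi> \<longleftrightarrow> satisfiable TYPE('w) L2 (tr4 A \<phi>)"
proof -
  have "L1 = add_Cond4 A L2"
    using assms(1,2) by (simp add: add_Cond4_def fun_eq_iff)
  then show ?thesis by (simp add: satisfiable_tr4)
qed

end
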